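(* Let $p$ be a prime number and $k$ an integer with $2\leq k\leq v-2$. Let $G$ and $G'$ be two graphs on the same vertex set $V$ of $v$ vertices (possibly infinite). Assume that for all $k$-element subsets $K$ of $V$, $e(G_{\restriction K}) \equiv e(G'_{\restriction K}) \pmod p$. 1) If $p\geq 3$ and $k\not\equiv 0,1 \pmod p$, then $G'=G$. 2) If $p\geq 3$ and $k\equiv 0 \pmod p$, then $G'=G$, or one of the graphs $G,G'$ is the complete graph and the other is the empty graph. 3) If $p=2$ and $k\equiv 2 \pmod 4$, then $G'=G$.
   Context: Graphs are simple undirected graphs (edges are 2-element subsets of $V$). For $K\subseteq V$, $G_{\restriction K}$ is the subgraph of $G$ induced on $K$, and $e(H)$ denotes the number of edges of a graph $H$. *)

theory Defs
  imports "HOL-Library.Ramsey" "HOL-Number_Theory.Cong" "HOL-Computational_Algebra.Primes"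
begin

text \<open>A graph is a pair of a vertex set, possibly infinite, and a set of edges. The graph is
  determined by this pair, so equality of graphs is equality of pairs. The library notation
  \<open>[V]\<^bsup>n\<^esup>\<close>, i.e. \<open>nsets V n\<close>, is the set of finite \<open>n\<close>-element subsets of \<open>V\<close>.\<close>

type_synonym 'a graph = "'a set \<times> 'a set set"

abbreviation verts :: "'a graph \<Rightarrow> 'a set" where
  "verts G \<equiv> fst G"

abbreviation edges :: "'a graph \<Rightarrow> 'a set set" where
  "edges G \<equiv> snd G"

definition simple_graph :: "'a graph \<Rightarrow> bool" where
  "simple_graph G \<longleftrightarrow> edges G \<subseteq> [verts G]\<^bsup>2\<^esup>"

text \<open>Only meant for \<open>K \<subseteq> verts G\<close>.\<close>

definition induced_subgraph :: "'a graph \<Rightarrow> 'a set \<Rightarrow> 'a graph" where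
  "induced_subgraph G K = (K, {e \<in> edges G. e \<subseteq> K})"

text \<open>Only meant for graphs with finitely many edges, since \<open>card\<close> of an infinite set is \<open>0\<close>.\<close>

definition num_edges :: "'a graph \<Rightarrow> nat" where
  "num_edges H = card (edges H)"

definition complete_graph :: "'a set \<Rightarrow> 'a graph" where
  "complete_graph V = (V, [V]\<^bsup>2\<^esup>)"

definition empty_graph :: "'a set \<Rightarrow> 'a graph" where
  "empty_graph V = (V, {})"

end

theory Submission
  imports Defs
begin

text \<open>Let \<open>w e \<in> {-1, 0, 1}\<close> be the difference of the indicator functions of the two edge sets.
  Its sum over the pairs in every \<open>k\<close>-set vanishes modulo \<open>p\<close>. Comparing two \<open>k\<close>-sets
  that differ in one vertex, and then two such comparisons, shows that \<open>w {a, c} - w {b, c}\<close>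
  does not depend on \<open>c\<close> modulo \<open>p\<close>. Summing this over \<open>k - 1\<close> choices of \<open>c\<close> gives
  \<open>(k - 1) * (w {a, c} - w {b, c}) = 0\<close>, so if \<open>p\<close> does not divide \<open>k - 1\<close> then \<open>w\<close> is
  a constant \<open>z\<close> modulo \<open>p\<close>, and \<open>(k choose 2) * z = 0\<close>. In cases 1 and 3 the binomial
  coefficient is invertible, so \<open>z = 0\<close>; in case 2, \<open>p \<ge> 3\<close> makes \<open>w\<close> itself constant.\<close>

lemma nsets_2_insert:
  assumes "a \<notin> S"
  shows "[insert a S]\<^bsup>2\<^esup> = [S]\<^bsup>2\<^esup> \<union> (\<lambda>s. {a, s}) ` S"
  using assms by (auto simp: nsets_2_eq doubleton_eq_iff insert_commute)

lemma sum_nsets_2_insert: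
  fixes w :: "'a set \<Rightarrow> 'b::comm_monoid_add"
  assumes "finite S" "a \<notin> S"
  shows "sum w ([insert a S]\<^bsup>2\<^esup>) = sum w ([S]\<^bsup>2\<^esup>) + (\<Sum>s\<in>S. w {a, s})"
proof -
  have inj: "inj_on (\<lambda>s. {a, s}) S"
    by (auto simp: inj_on_def doubleton_eq_iff)
  have "[S]\<^bsup>2\<^esup> \<inter> (\<lambda>s. {a, s}) ` S = {}"
    using assms(2) by (auto simp: nsets_def)
  then show ?thesis
    using assms by (simp add: nsets_2_insert sum.union_disjoint finite_imp_finite_nsets
        sum.reindex[OF inj] o_def)
qed

text \<open>Supplies the auxiliary vertex sets avoiding a few given vertices. Removing a finite
  \<open>F\<close> keeps an infinite \<open>V\<close> infinite, so counting matters only for finite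
  \<open>V\<close>.\<close>

lemma nsets_Diff_nonempty:
  assumes "finite F" "F \<subseteq> V" "finite V \<Longrightarrow> n + card F \<le> card V"
  shows "[V - F]\<^bsup>n\<^esup> \<noteq> {}"
  using assms by (auto simp: nsets_eq_empty_iff card_Diff_subset)

text \<open>The modulus is arbitrary because the only cancellation is of the factor
  \<open>k - 1\<close>, which \<open>coprime\<close> permits. The bound \<open>k + 2\<close> leaves
  room for \<open>k - 2\<close> vertices besides four given ones.\<close>

lemma pair_weight_constant:
  fixes w :: "'a set \<Rightarrow> int" and m :: int and k :: nat
  assumes k: "2 \<le> k" and V: "finite V \<Longrightarrow> k + 2 \<le> card V"
    and coprime: "coprime (int (k - 1)) m"
    and zero: "\<And>K. K \<in> [V]\<^bsup>k\<^esup> \<Longrightarrow> [sum w ([K]\<^bsup>2\<^esup>) = 0] (mod m)"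
  obtains z where "\<And>e. e \<in> [V]\<^bsup>2\<^esup> \<Longrightarrow> [w e = z] (mod m)"
    and "[int (k choose 2) * z = 0] (mod m)"
proof -
  \<comment> \<open>The \<open>k\<close>-sets \<open>insert a S\<close> and
    \<open>insert b S\<close> share all pairs inside \<open>S\<close>; cancelling these leaves the
    two stars.\<close>
  have star: "[(\<Sum>s\<in>S. w {a, s}) = (\<Sum>s\<in>S. w {b, s})] (mod m)"
    if S: "S \<in> [V - {a, b}]\<^bsup>(k - 1)\<^esup>" and ab: "a \<in> V" "b \<in> V" for a b S
  proof -
    have S': "finite S" "a \<notin> S" "b \<notin> S" "S \<subseteq> V" "card S = k - 1"
      using S by (auto simp: nsets_def)
    have "[sum w ([insert x S]\<^bsup>2\<^esup>) = 0] (mod m)" if "x \<in> {a, b}" for x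
      using that S' ab k by (intro zero) (auto simp: nsets_def)
    from cong_trans[OF this[of a] cong_sym[OF this[of b]]] show ?thesis
      using S' by (simp add: sum_nsets_2_insert cong_add_lcancel)
  qed
  have exchange: "[w {a, c} - w {b, c} = w {a, d} - w {b, d}] (mod m)"
    if abcd: "{a, b, c, d} \<subseteq> V" and "a \<noteq> b" "c \<notin> {a, b}" "d \<notin> {a, b}" for a b c d
  proof (cases "c = d")
    case False
    obtain R where R: "R \<in> [V - {a, b, c, d}]\<^bsup>(k - 2)\<^esup>"
    proof -
      have "k - 2 + card {a, b, c, d} \<le> card V" if "finite V"
        using V[OF that] k \<open>a \<noteq> b\<close> \<open>c \<notin> {a, b}\<close> \<open>d \<notin> {a, b}\<close> False by auto
      then have "[V - {a, b, c, d}]\<^bsup>(k - 2)\<^esup> \<noteq> {}"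
        using abcd by (intro nsets_Diff_nonempty) auto
      then show thesis using that by blast
    qed
    then have R': "finite R" "R \<subseteq> V - {a, b, c, d}" "card R = k - 2"
      by (auto simp: nsets_def)
    \<comment> \<open>This is \<open>star\<close> for \<open>insert x R\<close> with the term of
      \<open>x\<close> split off. Subtracting the instances for \<open>c\<close> and
      \<open>d\<close> cancels both sums over \<open>R\<close>.\<close>
    have "[w {a, x} + (\<Sum>s\<in>R. w {a, s}) = w {b, x} + (\<Sum>s\<in>R. w {b, s})] (mod m)"
      if "x \<in> {c, d}" for x
    proof -
      have "x \<notin> R" using R' that by auto
      moreover have "insert x R \<in> [V - {a, b}]\<^bsup>(k - 1)\<^esup>"
        using \<open>x \<notin> R\<close> R' that \<open>{a, b, c, d} \<subseteq> V\<close> \<open>c \<notin> {a, b}\<close> \<open>d \<notin> {a, b}\<close> k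
        by (auto simp: nsets_def)
      ultimately show ?thesis
        using star[of "insert x R" a b] \<open>finite R\<close> abcd
        by (simp only: sum.insert insert_subset not_False_eq_True)
    qed
    from cong_diff[OF this[of c] this[of d]]
    have "[w {a, c} - w {a, d} = w {b, c} - w {b, d}] (mod m)"
      by simp
    then show ?thesis
      by (simp add: cong_iff_dvd_diff algebra_simps)
  qed simp
  have move: "[w {a, c} = w {b, c}] (mod m)"
    if abc: "a \<in> V" "b \<in> V" "c \<in> V" and ne: "c \<notin> {a, b}" for a b c
  proof (cases "a = b")
    case False
    obtain R where R: "R \<in> [V - {a, b, c}]\<^bsup>(k - 2)\<^esup>"
    proof -
      have "k - 2 + card {a, b, c} \<le> card V" if "finite V"
        using V[OF that] k ne False by auto
      then have "[V - {a, b, c}]\<^bsup>(k - 2)\<^esup> \<noteq> {}"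
        using abc by (intro nsets_Diff_nonempty) auto
      then show thesis using that by blast
    qed
    define S where "S = insert c R"
    have R': "finite R" "R \<subseteq> V - {a, b, c}" "card R = k - 2"
      using R by (auto simp: nsets_def)
    have S: "S \<in> [V - {a, b}]\<^bsup>(k - 1)\<^esup>" "S \<subseteq> V - {a, b}" "card S = k - 1"
      using R' abc ne k by (auto simp: nsets_def S_def card_insert_if)
    \<comment> \<open>By \<open>exchange\<close> every summand may be replaced by the one at
      \<open>c\<close>, giving \<open>k - 1\<close> equal terms, while \<open>star\<close> makes
      their sum vanish.\<close>
    have "[(\<Sum>s\<in>S. w {a, s} - w {b, s}) = (\<Sum>s\<in>S. w {a, c} - w {b, c})] (mod m)"
    proof (rule cong_sum)
      show "[w {a, s} - w {b, s} = w {a, c} - w {b, c}] (mod m)" if "s \<in> S" for s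
        using S(2) abc ne False that by (intro exchange) auto
    qed
    then have "[(\<Sum>s\<in>S. w {a, s} - w {b, s}) = int (k - 1) * (w {a, c} - w {b, c})] (mod m)"
      by (simp only: sum_constant S(3))
    moreover have "[(\<Sum>s\<in>S. w {a, s} - w {b, s}) = 0] (mod m)"
      using star[OF S(1) abc(1,2)] by (simp add: sum_subtractf cong_diff_iff_cong_0)
    ultimately have "[int (k - 1) * (w {a, c} - w {b, c}) = int (k - 1) * 0] (mod m)"
      unfolding cong_def by simp
    then show ?thesis
      using coprime by (simp only: cong_mult_lcancel cong_diff_iff_cong_0)
  qed simp
  have "[V]\<^bsup>2\<^esup> \<noteq> {}" "[V]\<^bsup>k\<^esup> \<noteq> {}"
    using V by (auto simp: nsets_eq_empty_iff)
  then obtain P K where P: "P \<in> [V]\<^bsup>2\<^esup>" and K: "K \<in> [V]\<^bsup>k\<^esup>"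
    by blast
  then obtain x y where xy: "P = {x, y}" "x \<in> V" "y \<in> V" "x \<noteq> y"
    by (auto simp: nsets_2_eq)
  \<comment> \<open>Endpoints are moved one at a time, from \<open>{a, b}\<close> to
    \<open>{x, b}\<close> to \<open>{x, y}\<close>. The case \<open>b = x\<close> is separate
    because \<open>move\<close> requires the kept endpoint to differ from both exchanged
    ones.\<close>
  have const: "[w e = w {x, y}] (mod m)" if e: "e \<in> [V]\<^bsup>2\<^esup>" for e
  proof -
    obtain a b where ab: "e = {a, b}" "a \<in> V" "b \<in> V" "a \<noteq> b"
      using e by (auto simp: nsets_2_eq)
    have to_x: "[w {c, x} = w {x, y}] (mod m)" if "c \<in> V" "c \<noteq> x" for c
      using move[of c y x] that xy by (simp add: insert_commute)
    show ?thesis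
    proof (cases "b = x")
      case True
      then show ?thesis using to_x[of a] ab by simp
    next
      case False
      then have "[w {a, b} = w {x, b}] (mod m)"
        using move[of a x b] ab xy by auto
      also have "w {x, b} = w {b, x}" by (simp add: insert_commute)
      also have "[w {b, x} = w {x, y}] (mod m)" using to_x[of b] False ab by simp
      finally show ?thesis by (simp add: ab)
    qed
  qed
  have "[(\<Sum>e\<in>[K]\<^bsup>2\<^esup>. w e) = (\<Sum>e\<in>[K]\<^bsup>2\<^esup>. w {x, y})] (mod m)"
    using K by (intro cong_sum const) (auto simp: nsets_def)
  moreover have "card ([K]\<^bsup>2\<^esup>) = k choose 2"
    using K by (simp add: nsets_def[of V])
  ultimately have "[int (k choose 2) * w {x, y} = 0] (mod m)"
    using zero[OF K] by (simp add: cong_def)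
  then show thesis using const that by blast
qed

text \<open>Integer valued, since truncated subtraction would hide the edges of \<open>G'\<close>
  missing from \<open>G\<close>.\<close>

definition edge_diff :: "'a graph \<Rightarrow> 'a graph \<Rightarrow> 'a set \<Rightarrow> int" where
  "edge_diff G G' e = of_bool (e \<in> edges G) - of_bool (e \<in> edges G')"

lemma num_edges_induced_subgraph:
  assumes "simple_graph G" "finite K"
  shows "int (num_edges (induced_subgraph G K)) = (\<Sum>e\<in>[K]\<^bsup>2\<^esup>. of_bool (e \<in> edges G))"
proof -
  have "{e \<in> edges G. e \<subseteq> K} = [K]\<^bsup>2\<^esup> \<inter> {e. e \<in> edges G}"
    using assms(1) by (auto simp: simple_graph_def nsets_def)
  then show ?thesis
    using assms(2) by (simp add: num_edges_def induced_subgraph_def finite_imp_finite_nsets)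
qed

lemma sum_edge_diff:
  assumes "simple_graph G" "simple_graph G'" "finite K"
  shows "sum (edge_diff G G') ([K]\<^bsup>2\<^esup>) =
    int (num_edges (induced_subgraph G K)) - int (num_edges (induced_subgraph G' K))"
  using assms by (simp add: num_edges_induced_subgraph edge_diff_def sum_subtractf)

lemma graph_eq_of_edge_diff:
  assumes "simple_graph G" "simple_graph G'" "verts G = V" "verts G' = V"
    and "\<And>e. e \<in> [V]\<^bsup>2\<^esup> \<Longrightarrow> edge_diff G G' e = 0"
  shows "G' = G"
proof -
  have "edges G' = edges G"
    using assms by (fastforce simp: simple_graph_def edge_diff_def of_bool_def split: if_splits)
  then show ?thesis using assms(3,4) by (simp add: prod_eq_iff)
qed

text \<open>A difference of two truth values is 1 only for true minus false. The value -1 is treated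
  by exchanging the graphs, via \<open>edge_diff_swap\<close>.\<close>

lemma complete_empty_of_edge_diff:
  assumes "simple_graph G" "simple_graph G'" "verts G = V" "verts G' = V"
    and "\<And>e. e \<in> [V]\<^bsup>2\<^esup> \<Longrightarrow> edge_diff G G' e = 1"
  shows "G = complete_graph V" "G' = empty_graph V"
proof -
  have "e \<in> edges G \<and> e \<notin> edges G'" if "e \<in> [V]\<^bsup>2\<^esup>" for e
    using assms(5)[OF that] by (auto simp: edge_diff_def of_bool_def split: if_splits)
  then have "edges G = [V]\<^bsup>2\<^esup>" "edges G' = {}"
    using assms(1-4) by (auto simp: simple_graph_def)
  then show "G = complete_graph V" "G' = empty_graph V"
    using assms(3,4) by (simp_all add: complete_graph_def empty_graph_def prod_eq_iff)
qed

lemma abs_edge_diff_le: "\<bar>edge_diff G G' e\<bar> \<le> 1"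
  by (simp add: edge_diff_def of_bool_def)

lemma edge_diff_swap: "edge_diff G' G e = - edge_diff G G' e"
  by (simp add: edge_diff_def)

text \<open>A multiple of \<open>m\<close> of absolute value below \<open>m\<close> is zero. This
  turns congruences between the small values of \<open>edge_diff\<close> into equalities.\<close>

lemma cong_imp_eq_int:
  fixes x y m :: int
  assumes "[x = y] (mod m)" "\<bar>x - y\<bar> < m"
  shows "x = y"
  using assms dvd_imp_le_int[of "x - y" m] by (auto simp: cong_iff_dvd_diff)

theorem theorem1p5:
  fixes p k :: nat and V :: "'a set" and G G' :: "'a graph"
  assumes "prime p"
    and "2 \<le> k"
    and "finite V \<Longrightarrow> k + 2 \<le> card V"
    and "simple_graph G" and "verts G = V"
    and "simple_graph G'" and "verts G' = V"
    and "\<And>K. K \<in> [V]\<^bsup>k\<^esup> \<Longrightarrow>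
           [num_edges (induced_subgraph G K) = num_edges (induced_subgraph G' K)] (mod p)"
  shows "(p \<ge> 3 \<and> \<not> [k = 0] (mod p) \<and> \<not> [k = 1] (mod p) \<longrightarrow> G' = G) \<and>
         (p \<ge> 3 \<and> [k = 0] (mod p) \<longrightarrow>
            G' = G \<or>
            (G = complete_graph V \<and> G' = empty_graph V) \<or>
            (G' = complete_graph V \<and> G = empty_graph V)) \<and>
         (p = 2 \<and> [k = 2] (mod 4) \<longrightarrow> G' = G)"
proof -
  let ?w = "edge_diff G G'"
  have zero: "[sum ?w ([K]\<^bsup>2\<^esup>) = 0] (mod int p)" if "K \<in> [V]\<^bsup>k\<^esup>" for K
  proof -
    have "finite K" using that by (simp add: nsets_def)
    then show ?thesis
      using assms(8)[OF that] assms(4,6)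
      by (simp add: sum_edge_diff cong_diff_iff_cong_0 cong_int_iff)
  qed
  have const: thesis
    if "\<not> p dvd k - 1"
      and "\<And>z. (\<And>e. e \<in> [V]\<^bsup>2\<^esup> \<Longrightarrow> [?w e = z] (mod int p)) \<Longrightarrow>
        [int (k choose 2) * z = 0] (mod int p) \<Longrightarrow> thesis" for thesis
  proof (rule pair_weight_constant[OF assms(2,3) _ zero])
    show "coprime (int (k - 1)) (int p)"
      using prime_imp_coprime_nat[OF \<open>prime p\<close> that(1)]
      by (simp only: coprime_int_iff coprime_commute)
  qed (use that(2) in auto)
  have eq: "G' = G" if "\<not> p dvd k - 1" "\<not> p dvd k choose 2"
  proof (rule const[OF that(1)])
    fix z assume z: "\<And>e. e \<in> [V]\<^bsup>2\<^esup> \<Longrightarrow> [?w e = z] (mod int p)"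
      and "[int (k choose 2) * z = 0] (mod int p)"
    moreover have "prime (int p)" using \<open>prime p\<close> by simp
    ultimately have "[z = 0] (mod int p)"
      using that(2) by (auto simp: cong_0_iff prime_dvd_mult_iff)
    then have "?w e = 0" if "e \<in> [V]\<^bsup>2\<^esup>" for e
    proof (intro cong_imp_eq_int)
      show "[?w e = 0] (mod int p)"
        using z[OF that] \<open>[z = 0] (mod int p)\<close> by (rule cong_trans)
      \<comment> \<open>Comparison with 0 needs only \<open>1 < p\<close>, so \<open>eq\<close> also
        serves \<open>p = 2\<close>.\<close>
      show "\<bar>?w e - 0\<bar> < int p"
        using abs_edge_diff_le[of G G' e] prime_ge_2_nat[OF \<open>prime p\<close>] by linarith
    qed
    then show "G' = G" using assms(4-7) by (intro graph_eq_of_edge_diff)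
  qed
  have choose: "2 * (k choose 2) = k * (k - 1)"
    unfolding choose_two by (rule dvd_mult_div_cancel) auto
  have dvd_pred: "p dvd k - 1 \<longleftrightarrow> [k = 1] (mod p)"
    using assms(2) by (simp add: cong_altdef_nat)
  have case1: "G' = G" if "p \<ge> 3" "\<not> [k = 0] (mod p)" "\<not> [k = 1] (mod p)"
  proof (rule eq)
    \<comment> \<open>A prime dividing the binomial coefficient divides its double
      \<open>k * (k - 1)\<close>, hence one of the two factors.\<close>
    have "\<not> p dvd k * (k - 1)"
      using that(2,3) dvd_pred \<open>prime p\<close> by (simp add: cong_0_iff prime_dvd_mult_iff)
    then show "\<not> p dvd k choose 2" by (metis choose dvd_mult)
  qed (use that dvd_pred in simp)
  have case2: "G' = G \<or> (G = complete_graph V \<and> G' = empty_graph V) \<or>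
      (G' = complete_graph V \<and> G = empty_graph V)" if "p \<ge> 3" "[k = 0] (mod p)"
  proof (rule const)
    show "\<not> p dvd k - 1"
    proof
      assume "p dvd k - 1"
      moreover have "p dvd k" using that(2) by (simp add: cong_0_iff)
      ultimately have "p dvd k - (k - 1)" by (metis dvd_diff_nat)
      then show False using assms(2) that(1) by simp
    qed
  next
    fix z assume z: "\<And>e. e \<in> [V]\<^bsup>2\<^esup> \<Longrightarrow> [?w e = z] (mod int p)"
    have "[V]\<^bsup>2\<^esup> \<noteq> {}"
      using assms(3) by (auto simp: nsets_eq_empty_iff)
    then obtain e0 where e0: "e0 \<in> [V]\<^bsup>2\<^esup>"
      by blast
    have same: "?w e = ?w e0" if "e \<in> [V]\<^bsup>2\<^esup>" for e
    proof (rule cong_imp_eq_int)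
      show "[?w e = ?w e0] (mod int p)"
        using z[OF that] z[OF e0] by (metis cong_sym cong_trans)
      \<comment> \<open>Two weights can be 2 apart, so \<open>p \<ge> 3\<close> is essential: modulo
        2 the values 1 and -1 agree.\<close>
      show "\<bar>?w e - ?w e0\<bar> < int p"
        using abs_edge_diff_le[of G G' e] abs_edge_diff_le[of G G' e0] \<open>p \<ge> 3\<close> by linarith
    qed
    consider "?w e0 = 0" | "?w e0 = 1" | "edge_diff G' G e0 = 1"
      using abs_edge_diff_le[of G G' e0] edge_diff_swap[of G' G e0] by linarith
    then show ?thesis
    proof cases
      case 1
      then have "G' = G"
        using assms(4-7) same by (intro graph_eq_of_edge_diff) auto
      then show ?thesis by simp
    next
      case 2
      then show ?thesis
        using complete_empty_of_edge_diff[OF assms(4,6,5,7)] same by simp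
    next
      case 3
      then have "edge_diff G' G e = 1" if "e \<in> [V]\<^bsup>2\<^esup>" for e
        using same[OF that] by (simp add: edge_diff_swap[of G' G])
      then show ?thesis
        using complete_empty_of_edge_diff[OF assms(6,4,7,5)] by blast
    qed
  qed
  have case3: "G' = G" if "p = 2" "[k = 2] (mod 4)"
  proof -
    have "k mod 4 = 2" using that(2) by (simp add: cong_def)
    then obtain q where q: "k = 4 * q + 2"
      by (metis mult_div_mod_eq)
    \<comment> \<open>Both factors are odd and the second is \<open>k - 1\<close>, so 2 divides
      neither \<open>k - 1\<close> nor the binomial coefficient, as \<open>eq\<close>
      requires.\<close>
    then have "k choose 2 = (2 * q + 1) * (4 * q + 1)"
      using choose by simp
    then show ?thesis using q that(1) by (intro eq) auto
  qed
  show ?thesis using case1 case2 case3 by blast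
qed

end
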